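(* Let $V\in\mathcal V^+\cup\mathcal V^-$. Then for any $\mathbf x_0\in S$ the following statements hold: (i) $V$ is weak ergodic at the point $\mathbf x_0$; (ii) if $V\in\mathcal V^+$, then $V$ is ergodic at the point $\mathbf x_0$; (iii) if $V\in\mathcal V^-$, then $V$ is ergodic at the point $\mathbf x_0$ if and only if $\omega_V(\mathbf x_0)\neq\emptyset$.
   Context: $\ell^1$ is the space of absolutely summable real sequences $\mathbf x=(x_k)_{k\ge1}$ with norm $\|\mathbf x\|=\sum_k|x_k|$, and $S=\{\mathbf x\in\ell^1: x_k\ge0\ \text{for all }k,\ \|\mathbf x\|=1\}$. A Volterra operator is a map $V:S\to S$ of the form $(V(\mathbf x))_k=x_k\left(1+\sum_{i=1}^\infty a_{ki}x_i\right)$, $k\in\mathbb N$, where $(a_{ki})_{k,i\in\mathbb N}$ is a real matrix with $a_{ki}=-a_{ik}$ and $|a_{ki}|\le1$ for all $k,i$; this matrix is uniquely determined by $V$. $\mathcal V^+$ (resp. $\mathcal V^-$) is the set of Volterra operators with $a_{ki}\ge0$ (resp. $a_{ki}\le0$) for all $k<i$. $V^n$ is the $n$-th iterate of $V$, $V^0$ being the identity. $V$ is called ergodic at $\mathbf x_0\in S$ if the limit $\lim_{n\to\infty}\frac1n\sum_{k=0}^{n}V^k(\mathbf x_0)$ exists in $\ell^1$-norm, and weak ergodic at $\mathbf x_0$ if this limit exists in the sense of pointwise (coordinatewise) convergence. $\omega_V(\mathbf x_0)$ is the set of all limits, in $\ell^1$-norm, of subsequences $V^{n_j}(\mathbf x_0)$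 ($n_j\to\infty$) of the trajectory $\{V^n(\mathbf x_0)\}$. *)

theory Defs
  imports Complex_Main "HOL-Library.FuncSet"
begin

text \<open>
  Sequences are functions on \<^typ>\<open>nat\<close>, so coordinates are numbered from 0 instead of from 1.
  Only the order of the indices matters below.
\<close>

definition ell1 :: "(nat \<Rightarrow> real) set" where
  "ell1 = {x. summable (\<lambda>k. \<bar>x k\<bar>)}"

definition l1_norm :: "(nat \<Rightarrow> real) \<Rightarrow> real" where
  "l1_norm x = (\<Sum>k. \<bar>x k\<bar>)"

definition l1_simplex :: "(nat \<Rightarrow> real) set" where
  "l1_simplex = {x \<in> ell1. (\<forall>k. 0 \<le> x k) \<and> l1_norm x = 1}"

definition l1_tendsto :: "(nat \<Rightarrow> nat \<Rightarrow> real) \<Rightarrow> (nat \<Rightarrow> real) \<Rightarrow> bool" where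
  "l1_tendsto X L \<longleftrightarrow>
     (\<forall>n. X n \<in> ell1) \<and> L \<in> ell1 \<and> (\<lambda>n. l1_norm (\<lambda>k. X n k - L k)) \<longlonglongrightarrow> 0"

definition volterra_matrix :: "(nat \<Rightarrow> nat \<Rightarrow> real) \<Rightarrow> bool" where
  "volterra_matrix a \<longleftrightarrow> (\<forall>k i. a k i = - a i k \<and> \<bar>a k i\<bar> \<le> 1)"

text \<open>
  An operator on the simplex is a function on all sequences of which only the values on the
  simplex are constrained; its values elsewhere are never used.
\<close>

definition volterra_with :: "((nat \<Rightarrow> real) \<Rightarrow> (nat \<Rightarrow> real)) \<Rightarrow> (nat \<Rightarrow> nat \<Rightarrow> real) \<Rightarrow> bool" where
  "volterra_with V a \<longleftrightarrow>
     volterra_matrix a \<and> V \<in> l1_simplex \<rightarrow> l1_simplex \<and>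
     (\<forall>x\<in>l1_simplex. \<forall>k. V x k = x k * (1 + (\<Sum>i. a k i * x i)))"

text \<open>
  The existential quantifiers below are harmless: the matrix is unique, see
  \<open>volterra_with_unique\<close>.
\<close>

definition volterra_plus :: "((nat \<Rightarrow> real) \<Rightarrow> (nat \<Rightarrow> real)) set" where
  "volterra_plus = {V. \<exists>a. volterra_with V a \<and> (\<forall>k i. k < i \<longrightarrow> 0 \<le> a k i)}"

definition volterra_minus :: "((nat \<Rightarrow> real) \<Rightarrow> (nat \<Rightarrow> real)) set" where
  "volterra_minus = {V. \<exists>a. volterra_with V a \<and> (\<forall>k i. k < i \<longrightarrow> a k i \<le> 0)}"

text \<open>
  The normalisation is \<open>1/n\<close> although the sum has \<open>n + 1\<close> terms. The value at
  \<open>n = 0\<close> is 0 by convention and does not affect limits.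
\<close>

definition cesaro :: "((nat \<Rightarrow> real) \<Rightarrow> (nat \<Rightarrow> real)) \<Rightarrow> (nat \<Rightarrow> real) \<Rightarrow> nat \<Rightarrow> nat \<Rightarrow> real" where
  "cesaro V x0 n = (\<lambda>i. 1 / real n * (\<Sum>k=0..n. (V ^^ k) x0 i))"

definition ergodic_at :: "((nat \<Rightarrow> real) \<Rightarrow> (nat \<Rightarrow> real)) \<Rightarrow> (nat \<Rightarrow> real) \<Rightarrow> bool" where
  "ergodic_at V x0 \<longleftrightarrow> (\<exists>L. l1_tendsto (cesaro V x0) L)"

text \<open>
  That the coordinatewise limit is again in \<open>\<ell>\<^sup>1\<close> is no restriction, by Fatou's lemma.
\<close>

definition weak_ergodic_at :: "((nat \<Rightarrow> real) \<Rightarrow> (nat \<Rightarrow> real)) \<Rightarrow> (nat \<Rightarrow> real) \<Rightarrow> bool" where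
  "weak_ergodic_at V x0 \<longleftrightarrow> (\<exists>L\<in>ell1. \<forall>i. (\<lambda>n. cesaro V x0 n i) \<longlonglongrightarrow> L i)"

definition omega_limit :: "((nat \<Rightarrow> real) \<Rightarrow> (nat \<Rightarrow> real)) \<Rightarrow> (nat \<Rightarrow> real) \<Rightarrow> (nat \<Rightarrow> real) set" where
  "omega_limit V x0 =
     {y. \<exists>r :: nat \<Rightarrow> nat. strict_mono r \<and> l1_tendsto (\<lambda>j. (V ^^ r j) x0) y}"

lemma volterra_with_unique:
  assumes a: "volterra_with V a" and b: "volterra_with V b"
  shows "a = b"
proof (intro ext)
  fix k i :: nat
  show "a k i = b k i"
  proof (cases "k = i")
    case True
    have "a k k = - a k k" "b k k = - b k k"
      using a b unfolding volterra_with_def volterra_matrix_def by blast+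
    with True show ?thesis by simp
  next
    case False
    define x :: "nat \<Rightarrow> real" where "x = (\<lambda>j. if j \<in> {k, i} then 1/2 else 0)"
    have x_nonneg: "0 \<le> x j" for j by (simp add: x_def)
    have sums_x: "(\<lambda>j. c j * x j) sums (c k / 2 + c i / 2)" for c :: "nat \<Rightarrow> real"
    proof -
      have "(\<lambda>j. c j * x j) sums (\<Sum>j\<in>{k, i}. c j * x j)"
        by (rule sums_finite) (auto simp: x_def)
      then show ?thesis using False by (simp add: x_def)
    qed
    have "(\<lambda>j. \<bar>x j\<bar>) sums 1"
      using sums_x[of "\<lambda>_. 1"] x_nonneg by (simp add: abs_of_nonneg)
    then have x: "x \<in> l1_simplex"
      using x_nonneg by (auto simp: l1_simplex_def ell1_def l1_norm_def sums_iff)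
    have V: "V x k = 1/2 * (1 + (c k k / 2 + c k i / 2)) \<and> c k k = 0"
      if c: "volterra_with V c" for c
    proof -
      have "V x k = x k * (1 + (\<Sum>j. c k j * x j))"
        using c x unfolding volterra_with_def by blast
      moreover have "x k = 1/2" by (simp add: x_def)
      moreover have "(\<Sum>j. c k j * x j) = c k k / 2 + c k i / 2"
        using sums_x[of "c k"] by (simp add: sums_iff)
      moreover have "c k k = - c k k"
        using c unfolding volterra_with_def volterra_matrix_def by blast
      ultimately show ?thesis by simp
    qed
    from V[OF a] V[OF b] show ?thesis by simp
  qed
qed

end

theory Submission
  imports Defs "HOL-Analysis.Uniform_Limit"
begin

text \<open>
  For \<open>x\<close> in the simplex let \<open>S m x\<close> be the mass \<open>x 0 + ... + x (m - 1)\<close> of the first \<open>m\<close>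
  coordinates. Passing from \<open>x\<close> to \<open>V x\<close> changes it by the sum of \<open>a k i * x k * x i\<close> over all
  \<open>k < m\<close> and all \<open>i\<close>. The terms with \<open>i < m\<close> cancel because \<open>a\<close> is antisymmetric, and
  those with \<open>i \<ge> m\<close> have \<open>k < i\<close>, so that they all have the same sign. Hence along every
  trajectory each \<open>S m\<close> is monotone: increasing for \<open>volterra_plus\<close>, decreasing for
  \<open>volterra_minus\<close>. As it is bounded, it converges, and so does each coordinate, being a
  difference of two such masses (\<open>trajectory_pointwise_convergent\<close>). The trajectory itself, and
  with it its Cesaro means, therefore converges coordinatewise to some \<open>L\<close>, which is in
  \<open>\<ell>\<^sup>1\<close> with norm at most 1.

  For nonnegative sequences, coordinatewise convergence is convergence in norm exactly when no
  mass is lost in the limit (\<open>l1_convergent_iff_mass_preserved\<close>, a discrete form of Scheffe's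
  lemma). Applied to the Cesaro means, whose mass is \<open>(n + 1) / n\<close>, and to any subsequence of the
  trajectory, whose mass is 1, this says that ergodicity at \<open>x0\<close> and nonemptiness of the
  \<open>\<omega>\<close>-limit set are both equivalent to \<open>l1_norm L = 1\<close>. This is part (iii). For
  \<open>volterra_plus\<close> the masses \<open>S m\<close> increase with time, so none can escape to
  infinity and \<open>l1_norm L = 1\<close> holds automatically, which is part (ii).
\<close>

section \<open>Norm convergence of nonnegative sequences\<close>

lemma abs_coordinate_le_l1_norm:
  assumes "x \<in> ell1"
  shows "\<bar>x k\<bar> \<le> l1_norm x"
  using sum_le_suminf[of "\<lambda>k. \<bar>x k\<bar>" "{k}"] assms by (simp add: ell1_def l1_norm_def)

lemma ell1_summable: "x \<in> ell1 \<Longrightarrow> summable x"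
  by (simp add: ell1_def summable_rabs_cancel)

lemma ell1_diff:
  assumes "x \<in> ell1" "y \<in> ell1"
  shows "(\<lambda>k. x k - y k) \<in> ell1"
proof -
  have "summable (\<lambda>k. \<bar>x k\<bar> + \<bar>y k\<bar>)"
    using assms by (simp add: ell1_def summable_add)
  then show ?thesis
    unfolding ell1_def mem_Collect_eq by (rule summable_comparison_test') (simp add: abs_triangle_ineq4)
qed

lemma l1_norm_diff_le:
  assumes "x \<in> ell1" "y \<in> ell1"
  shows "\<bar>l1_norm x - l1_norm y\<bar> \<le> l1_norm (\<lambda>k. x k - y k)"
proof -
  have s: "summable (\<lambda>k. \<bar>x k\<bar>)" "summable (\<lambda>k. \<bar>y k\<bar>)" "summable (\<lambda>k. \<bar>x k - y k\<bar>)"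
    using assms ell1_diff[OF assms] by (simp_all add: ell1_def)
  have "l1_norm x \<le> (\<Sum>k. \<bar>x k - y k\<bar> + \<bar>y k\<bar>)"
    unfolding l1_norm_def by (intro suminf_le summable_add s) linarith
  moreover have "l1_norm y \<le> (\<Sum>k. \<bar>x k - y k\<bar> + \<bar>x k\<bar>)"
    unfolding l1_norm_def by (intro suminf_le summable_add s) linarith
  ultimately show ?thesis
    using s by (simp add: l1_norm_def suminf_add[symmetric] abs_le_iff)
qed

lemma l1_tendstoD:
  assumes "l1_tendsto X y"
  shows "X n \<in> ell1" "y \<in> ell1" "(\<lambda>n. l1_norm (\<lambda>k. X n k - y k)) \<longlonglongrightarrow> 0"
  using assms unfolding l1_tendsto_def by blast+

lemma l1_tendsto_imp_pointwise:
  assumes "l1_tendsto X y"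
  shows "(\<lambda>n. X n k) \<longlonglongrightarrow> y k"
proof -
  have "norm (X n k - y k) \<le> l1_norm (\<lambda>k. X n k - y k)" for n
    using abs_coordinate_le_l1_norm[OF ell1_diff[OF l1_tendstoD(1,2)[OF assms]]] by force
  then have "(\<lambda>n. X n k - y k) \<longlonglongrightarrow> 0"
    by (rule Lim_null_comparison[OF always_eventually[OF allI] l1_tendstoD(3)[OF assms]])
  then show ?thesis by (rule LIM_zero_cancel)
qed

lemma l1_tendsto_imp_norm:
  assumes "l1_tendsto X y"
  shows "(\<lambda>n. l1_norm (X n)) \<longlonglongrightarrow> l1_norm y"
proof -
  have "norm (l1_norm (X n) - l1_norm y) \<le> l1_norm (\<lambda>k. X n k - y k)" for n
    unfolding real_norm_def by (rule l1_norm_diff_le[OF l1_tendstoD(1,2)[OF assms]])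
  then have "(\<lambda>n. l1_norm (X n) - l1_norm y) \<longlonglongrightarrow> 0"
    by (rule Lim_null_comparison[OF always_eventually[OF allI] l1_tendstoD(3)[OF assms]])
  then show ?thesis by (rule LIM_zero_cancel)
qed

text \<open>
  Since \<open>\<bar>x - y\<bar> = x - y + 2 * max 0 (y - x)\<close>, and the summands \<open>x - y\<close> contribute only the
  difference of the masses, everything rests on the positive parts of \<open>L - X n\<close>. They are
  dominated by \<open>L\<close>, and Tannery's theorem lets their sum tend to 0.
\<close>

lemma l1_tendsto_if_mass_preserved:
  assumes nonneg: "\<And>n k. 0 \<le> X n k" and ell1: "\<And>n. X n \<in> ell1"
    and lim: "\<And>k. (\<lambda>n. X n k) \<longlonglongrightarrow> L k" and L: "L \<in> ell1"
    and mass: "(\<lambda>n. l1_norm (X n)) \<longlonglongrightarrow> l1_norm L"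
  shows "l1_tendsto X L"
proof -
  have L_nonneg: "0 \<le> L k" for k
    by (rule LIMSEQ_le_const[OF lim]) (simp add: nonneg)
  have norm_X: "l1_norm (X n) = suminf (X n)" for n
    by (simp add: l1_norm_def nonneg)
  have norm_L: "l1_norm L = suminf L"
    by (simp add: l1_norm_def L_nonneg)
  let ?p = "\<lambda>k n. max 0 (L k - X n k)"
  have p_le: "\<bar>?p k n\<bar> \<le> L k" for k n
    using nonneg[of n k] L_nonneg[of k] by auto
  have p_summable: "summable (\<lambda>k. ?p k n)" for n
    by (rule summable_comparison_test'[OF ell1_summable[OF L]]) (use p_le in simp)
  have "(\<lambda>n. \<Sum>k. ?p k n) \<longlonglongrightarrow> (\<Sum>k::nat. 0)"
  proof (rule tannerys_theorem[THEN conjunct2, THEN conjunct2])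
    show "?p k \<longlonglongrightarrow> 0" for k
      using tendsto_max[OF tendsto_const[of 0] tendsto_diff[OF tendsto_const[of "L k"] lim[of k]]] by simp
    show "\<forall>\<^sub>F (k, n) in sequentially \<times>\<^sub>F sequentially. norm (?p k n) \<le> L k"
      using p_le by (intro always_eventually) auto
  qed (simp_all add: ell1_summable L)
  then have "(\<lambda>n. l1_norm (X n) - l1_norm L + 2 * (\<Sum>k. ?p k n)) \<longlonglongrightarrow> l1_norm L - l1_norm L + 2 * 0"
    by (intro tendsto_intros mass) simp
  moreover have "l1_norm (\<lambda>k. X n k - L k) = l1_norm (X n) - l1_norm L + 2 * (\<Sum>k. ?p k n)" for n
  proof -
    have "(\<lambda>k. X n k - L k + 2 * ?p k n) sums (suminf (X n) - suminf L + 2 * (\<Sum>k. ?p k n))"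
      by (intro sums_add sums_diff sums_mult summable_sums ell1_summable ell1 L p_summable)
    moreover have "X n k - L k + 2 * ?p k n = \<bar>X n k - L k\<bar>" for k
      by (simp add: max_def)
    ultimately show ?thesis
      unfolding l1_norm_def[of "\<lambda>k. X n k - L k"] norm_X norm_L by (simp add: sums_iff)
  qed
  ultimately show ?thesis
    by (simp add: l1_tendsto_def ell1 L)
qed

text \<open>
  A norm limit has to agree with the coordinatewise limit, so that the existence of any norm limit
  is a question about \<open>L\<close> alone. The limit mass \<open>s\<close> is a separate parameter because mass may
  escape to infinity, leaving \<open>l1_norm L < s\<close>.
\<close>

lemma l1_convergent_iff_mass_preserved:
  assumes nonneg: "\<And>n k. 0 \<le> X n k" and ell1: "\<And>n. X n \<in> ell1"
    and lim: "\<And>k. (\<lambda>n. X n k) \<longlonglongrightarrow> L k" and mass: "(\<lambda>n. l1_norm (X n)) \<longlonglongrightarrow> s"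
  shows "(\<exists>y. l1_tendsto X y) \<longleftrightarrow> L \<in> ell1 \<and> l1_norm L = s"
proof
  assume "\<exists>y. l1_tendsto X y"
  then obtain y where y: "l1_tendsto X y" ..
  have "y = L"
    using LIMSEQ_unique[OF l1_tendsto_imp_pointwise[OF y] lim] by blast
  with y show "L \<in> ell1 \<and> l1_norm L = s"
    using LIMSEQ_unique[OF l1_tendsto_imp_norm mass] by (auto simp: l1_tendsto_def)
next
  assume "L \<in> ell1 \<and> l1_norm L = s"
  then show "\<exists>y. l1_tendsto X y"
    using l1_tendsto_if_mass_preserved[OF nonneg ell1 lim] mass by blast
qed

section \<open>Cesaro means\<close>

lemma cesaro_tendsto_0:
  fixes v :: "nat \<Rightarrow> real"
  assumes "v \<longlonglongrightarrow> 0"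
  shows "(\<lambda>n. 1 / real n * (\<Sum>k=0..n. v k)) \<longlonglongrightarrow> 0"
proof (rule LIMSEQ_I)
  fix e :: real assume e: "0 < e"
  obtain N where N: "\<And>k. N \<le> k \<Longrightarrow> \<bar>v k\<bar> < e / 2"
    using LIMSEQ_D[OF assms, of "e / 2"] e by auto
  \<comment> \<open>The sum has \<open>n + 1\<close> terms, but is divided by \<open>n\<close>: the extra \<open>e / 2\<close> pays for one term.\<close>
  define C where "C = (\<Sum>k<N. \<bar>v k\<bar>) + e / 2"
  have C: "0 < C" using e by (simp add: C_def sum_nonneg add_nonneg_pos)
  have bound: "\<bar>\<Sum>k=0..n. v k\<bar> \<le> C + real n * (e / 2)" for n
  proof -
    have "\<bar>\<Sum>k=0..n. v k\<bar> \<le> (\<Sum>k=0..n. \<bar>v k\<bar>)" by (rule sum_abs)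
    also have "\<dots> \<le> (\<Sum>k=0..n. (if k < N then \<bar>v k\<bar> else 0) + e / 2)"
      using N e by (intro sum_mono) (auto simp: not_less intro: less_imp_le)
    also have "\<dots> = (\<Sum>k\<in>{0..n} \<inter> {..<N}. \<bar>v k\<bar>) + real (Suc n) * (e / 2)"
      by (simp add: sum.distrib sum.inter_restrict)
    also have "(\<Sum>k\<in>{0..n} \<inter> {..<N}. \<bar>v k\<bar>) \<le> (\<Sum>k<N. \<bar>v k\<bar>)"
      by (intro sum_mono2) auto
    finally show ?thesis by (simp add: C_def field_simps)
  qed
  obtain M :: nat where M: "2 * C / e < real M"
    using reals_Archimedean2 by blast
  show "\<exists>no. \<forall>n\<ge>no. norm (1 / real n * (\<Sum>k=0..n. v k) - 0) < e"
  proof (intro exI allI impI)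
    fix n assume n: "Suc M \<le> n"
    then have "2 * C / e < real n" using M by linarith
    then have "C < real n * (e / 2)" using e by (simp add: field_simps)
    then have "\<bar>\<Sum>k=0..n. v k\<bar> < real n * e"
      using bound[of n] by linarith
    moreover have "0 < real n" using n by simp
    ultimately show "norm (1 / real n * (\<Sum>k=0..n. v k) - 0) < e"
      by (simp add: abs_mult field_simps)
  qed
qed

lemma cesaro_const_tendsto:
  fixes c :: real
  shows "(\<lambda>n. 1 / real n * (\<Sum>k=0..n. c)) \<longlonglongrightarrow> c"
proof -
  have "(\<lambda>n. c + c * (1 / real n)) \<longlonglongrightarrow> c + c * 0"
    by (intro tendsto_intros lim_1_over_n)
  moreover have "\<forall>\<^sub>F n in sequentially. c + c * (1 / real n) = 1 / real n * (\<Sum>k=0..n. c)"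
    using eventually_gt_at_top[of 0] by eventually_elim (simp add: field_simps)
  ultimately show ?thesis
    using Lim_transform_eventually by fastforce
qed

lemma cesaro_tendsto:
  fixes u :: "nat \<Rightarrow> real"
  assumes "u \<longlonglongrightarrow> l"
  shows "(\<lambda>n. 1 / real n * (\<Sum>k=0..n. u k)) \<longlonglongrightarrow> l"
proof -
  have "(\<lambda>n. 1 / real n * (\<Sum>k=0..n. u k - l) + 1 / real n * (\<Sum>k=0..n. l)) \<longlonglongrightarrow> 0 + l"
    by (intro tendsto_add cesaro_tendsto_0 cesaro_const_tendsto LIM_zero assms)
  then show ?thesis
    by (simp add: sum_subtractf right_diff_distrib)
qed

section \<open>Trajectories of Volterra operators\<close>

lemma l1_simplex_D:
  assumes "x \<in> l1_simplex"
  shows "x \<in> ell1" "0 \<le> x k" "x sums 1" "l1_norm x = 1"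
  using assms ell1_summable[of x]
  by (auto simp: l1_simplex_def l1_norm_def sums_iff)

lemma trajectory_in_l1_simplex:
  assumes "volterra_with V a" "x \<in> l1_simplex"
  shows "(V ^^ n) x \<in> l1_simplex"
  using assms by (induction n) (auto simp: volterra_with_def)

text \<open>
  The double sum over the block \<open>{..<m} \<times> {..<m}\<close> is its own negative, because exchanging the two
  indices changes the sign of each term. Only the flow between the first \<open>m\<close> coordinates and the
  others is left.
\<close>

lemma volterra_partial_sum:
  assumes V: "volterra_with V a" and x: "x \<in> l1_simplex"
  shows "summable (\<lambda>i. a k (i + m) * x (i + m))"
    and "(\<Sum>k<m. V x k) = (\<Sum>k<m. x k) + (\<Sum>k<m. x k * (\<Sum>i. a k (i + m) * x (i + m)))"
proof -
  have anti: "a k i = - a i k" and a_le: "\<bar>a k i\<bar> \<le> 1" for k i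
    using V unfolding volterra_with_def volterra_matrix_def by blast+
  have summable_a: "summable (\<lambda>i. a k i * x i)" for k
  proof (rule summable_comparison_test')
    show "summable x" using l1_simplex_D(3)[OF x] by (rule sums_summable)
    show "norm (a k i * x i) \<le> x i" for i
      using mult_right_mono[OF a_le[of k i] l1_simplex_D(2)[OF x, of i]] l1_simplex_D(2)[OF x, of i]
      by (simp add: abs_mult)
  qed
  show "summable (\<lambda>i. a k (i + m) * x (i + m))"
    using summable_a by (subst summable_iff_shift[of "\<lambda>i. a k i * x i"])
  let ?B = "\<Sum>k<m. \<Sum>i<m. x k * (a k i * x i)"
  have "?B = (\<Sum>k<m. \<Sum>i<m. x i * (a i k * x k))"
    by (rule sum.swap)
  also have "\<dots> = (\<Sum>k<m. \<Sum>i<m. - (x k * (a k i * x i)))"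
    by (intro sum.cong refl) (subst anti, simp)
  also have "\<dots> = - ?B"
    by (simp add: sum_negf)
  finally have B: "?B = 0" by simp
  have "V x k = x k + (\<Sum>i<m. x k * (a k i * x i)) + x k * (\<Sum>i. a k (i + m) * x (i + m))" for k
  proof -
    have "V x k = x k * (1 + (\<Sum>i. a k i * x i))"
      using V x by (simp add: volterra_with_def)
    also have "(\<Sum>i. a k i * x i) = (\<Sum>i. a k (i + m) * x (i + m)) + (\<Sum>i<m. a k i * x i)"
      by (rule suminf_split_initial_segment[OF summable_a])
    finally show ?thesis
      by (simp add: algebra_simps sum_distrib_left)
  qed
  then have "(\<Sum>k<m. V x k) = (\<Sum>k<m. x k) + ?B + (\<Sum>k<m. x k * (\<Sum>i. a k (i + m) * x (i + m)))"
    by (simp add: sum.distrib)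
  with B show "(\<Sum>k<m. V x k) = (\<Sum>k<m. x k) + (\<Sum>k<m. x k * (\<Sum>i. a k (i + m) * x (i + m)))"
    by simp
qed

lemma volterra_plus_incseq:
  assumes "V \<in> volterra_plus" and x0: "x0 \<in> l1_simplex"
  shows "incseq (\<lambda>n. \<Sum>k<m. (V ^^ n) x0 k)"
proof -
  obtain a where V: "volterra_with V a" and sign: "\<And>k i. k < i \<Longrightarrow> 0 \<le> a k i"
    using assms by (auto simp: volterra_plus_def)
  have "(\<Sum>k<m. x k) \<le> (\<Sum>k<m. V x k)" if x: "x \<in> l1_simplex" for x
    unfolding volterra_partial_sum(2)[OF V x] using l1_simplex_D(2)[OF x] sign
    by (auto intro!: sum_nonneg mult_nonneg_nonneg suminf_nonneg volterra_partial_sum(1)[OF V x])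
  then show ?thesis
    using trajectory_in_l1_simplex[OF V x0] by (auto intro!: incseq_SucI)
qed

lemma volterra_minus_decseq:
  assumes "V \<in> volterra_minus" and x0: "x0 \<in> l1_simplex"
  shows "decseq (\<lambda>n. \<Sum>k<m. (V ^^ n) x0 k)"
proof -
  obtain a where V: "volterra_with V a" and sign: "\<And>k i. k < i \<Longrightarrow> a k i \<le> 0"
    using assms by (auto simp: volterra_minus_def)
  have "(\<Sum>k<m. V x k) \<le> (\<Sum>k<m. x k)" if x: "x \<in> l1_simplex" for x
  proof -
    have "(\<Sum>i. a k (i + m) * x (i + m)) \<le> 0" if "k < m" for k
      using suminf_le[OF _ volterra_partial_sum(1)[OF V x] summable_zero, of k m] that
        l1_simplex_D(2)[OF x] sign by (simp add: mult_nonpos_nonneg)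
    then show ?thesis
      unfolding volterra_partial_sum(2)[OF V x] using l1_simplex_D(2)[OF x]
      by (auto intro!: sum_nonpos mult_nonneg_nonpos)
  qed
  then show ?thesis
    using trajectory_in_l1_simplex[OF V x0] by (auto intro!: decseq_SucI)
qed

lemma volterra_trajectory_in_l1_simplex:
  assumes "V \<in> volterra_plus \<union> volterra_minus" and "x0 \<in> l1_simplex"
  shows "(V ^^ n) x0 \<in> l1_simplex"
  using assms trajectory_in_l1_simplex by (auto simp: volterra_plus_def volterra_minus_def)

lemma trajectory_pointwise_convergent:
  assumes V: "V \<in> volterra_plus \<union> volterra_minus" and x0: "x0 \<in> l1_simplex"
  obtains L where "\<And>k. (\<lambda>n. (V ^^ n) x0 k) \<longlonglongrightarrow> L k"
proof -
  let ?S = "\<lambda>m n. \<Sum>k<m. (V ^^ n) x0 k"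
  note D = l1_simplex_D[OF volterra_trajectory_in_l1_simplex[OF V x0]]
  have bounds: "0 \<le> ?S m n" "?S m n \<le> 1" for m n
    using sum_le_suminf[of "(V ^^ n) x0" "{..<m}"] D(2,3)[of n]
    by (simp_all add: sum_nonneg sums_iff)
  have "convergent (?S m)" for m
    using V
  proof
    assume "V \<in> volterra_plus"
    then have "incseq (?S m)" by (rule volterra_plus_incseq[OF _ x0])
    then obtain l where "?S m \<longlonglongrightarrow> l"
      using bounds(2) by (rule incseq_convergent[OF _ allI])
    then show ?thesis by (rule convergentI)
  next
    assume "V \<in> volterra_minus"
    then have "decseq (?S m)" by (rule volterra_minus_decseq[OF _ x0])
    then obtain l where "?S m \<longlonglongrightarrow> l"
      using bounds(1) by (rule decseq_convergent[OF _ allI])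
    then show ?thesis by (rule convergentI)
  qed
  then have "convergent (\<lambda>n. ?S (Suc k) n - ?S k n)" for k
    by (intro convergent_diff)
  then have "convergent (\<lambda>n. (V ^^ n) x0 k)" for k
    by simp
  then show thesis
    by (intro that[of "\<lambda>k. lim (\<lambda>n. (V ^^ n) x0 k)"]) (simp add: convergent_LIMSEQ_iff)
qed

lemma pointwise_limit_in_ell1:
  assumes X: "\<And>n. X n \<in> l1_simplex" and lim: "\<And>k. (\<lambda>n. X n k) \<longlonglongrightarrow> L k"
  shows "L \<in> ell1" and "\<And>k. 0 \<le> L k" and "l1_norm L \<le> 1"
proof -
  show nonneg: "0 \<le> L k" for k
    by (rule LIMSEQ_le_const[OF lim]) (simp add: l1_simplex_D(2)[OF X])
  have le: "(\<Sum>k<m. L k) \<le> 1" for m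
  proof (rule LIMSEQ_le_const2)
    show "(\<lambda>n. \<Sum>k<m. X n k) \<longlonglongrightarrow> (\<Sum>k<m. L k)"
      by (intro tendsto_sum lim)
    show "\<exists>N. \<forall>n\<ge>N. (\<Sum>k<m. X n k) \<le> 1"
      using sum_le_suminf[of "X n" "{..<m}" for n] l1_simplex_D[OF X] by (auto simp: sums_iff)
  qed
  then have "summable L"
    using nonneg summableI_nonneg_bounded by blast
  then show "L \<in> ell1" "l1_norm L \<le> 1"
    using nonneg suminf_le_const[OF _ le] by (simp_all add: ell1_def l1_norm_def)
qed

text \<open>
  Each initial block keeps at least the mass it has at time 0, so the limit dominates every partial
  sum of \<open>x0\<close>.
\<close>

lemma volterra_plus_limit_mass:
  assumes V: "V \<in> volterra_plus" and x0: "x0 \<in> l1_simplex"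
    and lim: "\<And>k. (\<lambda>n. (V ^^ n) x0 k) \<longlonglongrightarrow> L k"
  shows "l1_norm L = 1"
proof -
  have L: "L \<in> ell1" "\<And>k. 0 \<le> L k" "l1_norm L \<le> 1"
    using pointwise_limit_in_ell1[OF volterra_trajectory_in_l1_simplex[OF _ x0] lim] V by auto
  have "(\<Sum>k<m. x0 k) \<le> l1_norm L" for m
  proof -
    have "(\<lambda>n. \<Sum>k<m. (V ^^ n) x0 k) \<longlonglongrightarrow> (\<Sum>k<m. L k)"
      by (intro tendsto_sum lim)
    from incseq_le[OF volterra_plus_incseq[OF V x0] this, of 0]
    have "(\<Sum>k<m. x0 k) \<le> (\<Sum>k<m. L k)" by simp
    also have "\<dots> \<le> l1_norm L"
      using sum_le_suminf[OF ell1_summable[OF L(1)], of "{..<m}"] L(2) by (simp add: l1_norm_def)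
    finally show ?thesis .
  qed
  then have "suminf x0 \<le> l1_norm L"
    using l1_simplex_D(3)[OF x0] by (intro suminf_le_const) (auto simp: sums_iff)
  then show ?thesis
    using l1_simplex_D(3)[OF x0] L(3) by (simp add: sums_iff)
qed

lemma cesaro_ell1:
  assumes V: "\<And>n. (V ^^ n) x0 \<in> l1_simplex"
  shows "0 \<le> cesaro V x0 n k" and "cesaro V x0 n \<in> ell1"
    and "l1_norm (cesaro V x0 n) = 1 / real n * (\<Sum>k=0..n. 1)"
proof -
  show nonneg: "0 \<le> cesaro V x0 n k" for k
    unfolding cesaro_def by (intro mult_nonneg_nonneg sum_nonneg l1_simplex_D(2)[OF V]) simp
  have "cesaro V x0 n sums (1 / real n * (\<Sum>k=0..n. 1))"
    unfolding cesaro_def by (intro sums_mult sums_sum l1_simplex_D(3)[OF V])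
  then show "cesaro V x0 n \<in> ell1" "l1_norm (cesaro V x0 n) = 1 / real n * (\<Sum>k=0..n. 1)"
    using nonneg by (simp_all add: ell1_def l1_norm_def sums_iff)
qed

section \<open>Ergodicity\<close>

theorem theorem1p5:
  fixes V :: "(nat \<Rightarrow> real) \<Rightarrow> (nat \<Rightarrow> real)" and x0 :: "nat \<Rightarrow> real"
  assumes "V \<in> volterra_plus \<union> volterra_minus"
    and "x0 \<in> l1_simplex"
  shows "weak_ergodic_at V x0
    \<and> (V \<in> volterra_plus \<longrightarrow> ergodic_at V x0)
    \<and> (V \<in> volterra_minus \<longrightarrow> (ergodic_at V x0 \<longleftrightarrow> omega_limit V x0 \<noteq> {}))"
proof -
  obtain L where lim: "\<And>k. (\<lambda>n. (V ^^ n) x0 k) \<longlonglongrightarrow> L k"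
    using trajectory_pointwise_convergent[OF assms] by blast
  note orbit = volterra_trajectory_in_l1_simplex[OF assms]
  have L: "L \<in> ell1"
    using pointwise_limit_in_ell1(1)[OF orbit lim] .
  have cesaro_lim: "(\<lambda>n. cesaro V x0 n k) \<longlonglongrightarrow> L k" for k
    unfolding cesaro_def by (intro cesaro_tendsto lim)
  then have "weak_ergodic_at V x0"
    using L by (auto simp: weak_ergodic_at_def)
  moreover have ergodic: "ergodic_at V x0 \<longleftrightarrow> l1_norm L = 1"
  proof -
    have "(\<lambda>n. l1_norm (cesaro V x0 n)) \<longlonglongrightarrow> 1"
      unfolding cesaro_ell1(3)[OF orbit] by (rule cesaro_const_tendsto)
    from l1_convergent_iff_mass_preserved[OF cesaro_ell1(1,2)[OF orbit] cesaro_lim this]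
    show ?thesis using L by (simp add: ergodic_at_def)
  qed
  moreover have "omega_limit V x0 \<noteq> {} \<longleftrightarrow> l1_norm L = 1"
  proof -
    have "(\<exists>y. l1_tendsto (\<lambda>j. (V ^^ r j) x0) y) \<longleftrightarrow> l1_norm L = 1"
      if r: "strict_mono r" for r :: "nat \<Rightarrow> nat"
    proof -
      have "(\<lambda>j. (V ^^ r j) x0 k) \<longlonglongrightarrow> L k" for k
        using LIMSEQ_subseq_LIMSEQ[OF lim r] by (simp add: o_def)
      from l1_convergent_iff_mass_preserved[OF l1_simplex_D(2)[OF orbit] l1_simplex_D(1)[OF orbit] this]
      show ?thesis using L l1_simplex_D(4)[OF orbit] by simp
    qed
    \<comment> \<open>If no mass is lost, the whole trajectory converges, so the identity serves as subsequence.\<close>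
    moreover have "strict_mono (\<lambda>n::nat. n)"
      by (simp add: strict_mono_def)
    ultimately show ?thesis
      unfolding omega_limit_def by blast
  qed
  moreover have "ergodic_at V x0" if "V \<in> volterra_plus"
    using ergodic volterra_plus_limit_mass[OF that assms(2) lim] by simp
  ultimately show ?thesis by blast
qed

end
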